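(* Let $m_1, m_2, m_3$ be positive integers and let $T_1, T_2, T_3$ be any tournaments on $m_1, m_2, m_3$ vertices respectively. Let $H$ be the number of Hamilton cycles in the tournament $C_3(T_1,T_2,T_3)$. Then $$H \;\geq\; \sum_{k=1}^{\min\{m_1,m_2,m_3\}} S(m_1,k)\,S(m_2,k)\,S(m_3,k)\,\frac{(k!)^3}{k},$$ and equality holds when $T_1$, $T_2$ and $T_3$ are all transitive.
   Context: A tournament is an oriented complete graph on a finite vertex set: for every pair of distinct vertices $u,v$ exactly one of the directed edges $u\to v$, $v\to u$ is present (and there are no loops). A tournament is transitive if it contains no directed cycle. A Hamilton cycle in a tournament $T$ is a directed cycle in $T$ passing through every vertex of $T$ exactly once; Hamilton cycles are counted as subgraphs (sets of directed edges), so cyclic shifts of a vertex listing give the same cycle. Given tournaments $T_1, T_2, T_3$ on pairwise disjoint vertex sets, $C_3(T_1,T_2,T_3)$ denotes the tournament whose vertex set is the union of the three vertex sets, which contains all directed edges of $T_1$, $T_2$, $T_3$, and in which every edge between different parts is oriented from $T_1$ to $T_2$, from $T_2$ to $T_3$, and from $T_3$ to $T_1$. $S(m,k)$ denotes the Stirling number of the second kind, i.e. the number of set partitions of $\{1,2,\dots,m\}$ into exactly $k$ nonempty parts. *)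

theory Defs
  imports
    "Graph_Theory.Graph_Theory"
    "HOL-Combinatorics.Stirling"
    "HOL-Library.Disjoint_Sets"
begin

locale tournament = pair_digraph +
  assumes exactly_one_direction:
    "\<And>u v. u \<in> pverts G \<Longrightarrow> v \<in> pverts G \<Longrightarrow> u \<noteq> v \<Longrightarrow>
      (u, v) \<in> parcs G \<longleftrightarrow> (v, u) \<notin> parcs G"

locale transitive_tournament = tournament +
  assumes no_cycle: "\<And>p. \<not> cycle p"

text \<open>
  \<^const>\<open>pre_digraph.cycle\<close> is a predicate on lists of arcs.  Passing to the set of arcs
  identifies precisely the cyclic shifts of such a list; \<open>fst ` set p\<close> is the set of
  vertices visited.
\<close>

definition hamilton_cycles :: "'a pair_pre_digraph \<Rightarrow> ('a \<times> 'a) set set" where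
  "hamilton_cycles G =
    {set p | p. pre_digraph.cycle (with_proj G) p \<and> fst ` set p = pverts G}"

definition C3 :: "'a pair_pre_digraph \<Rightarrow> 'a pair_pre_digraph \<Rightarrow> 'a pair_pre_digraph \<Rightarrow>
    'a pair_pre_digraph" where
  "C3 T\<^sub>1 T\<^sub>2 T\<^sub>3 =
    \<lparr> pverts = pverts T\<^sub>1 \<union> pverts T\<^sub>2 \<union> pverts T\<^sub>3,
      parcs = parcs T\<^sub>1 \<union> parcs T\<^sub>2 \<union> parcs T\<^sub>3
        \<union> pverts T\<^sub>1 \<times> pverts T\<^sub>2 \<union> pverts T\<^sub>2 \<times> pverts T\<^sub>3 \<union> pverts T\<^sub>3 \<times> pverts T\<^sub>1 \<rparr>"

lemma tournament_C3:
  assumes T: "tournament T\<^sub>1" "tournament T\<^sub>2" "tournament T\<^sub>3"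
    and disj: "pverts T\<^sub>1 \<inter> pverts T\<^sub>2 = {}" "pverts T\<^sub>2 \<inter> pverts T\<^sub>3 = {}" "pverts T\<^sub>1 \<inter> pverts T\<^sub>3 = {}"
  shows "tournament (C3 T\<^sub>1 T\<^sub>2 T\<^sub>3)"
proof -
  have sub: "parcs T \<subseteq> pverts T \<times> pverts T" if "tournament T" for T :: "'a pair_pre_digraph"
  proof -
    interpret tournament T by fact
    show ?thesis using in_arcsD1 in_arcsD2 by auto
  qed
  have loop: "(u, u) \<notin> parcs T" if "tournament T" for T :: "'a pair_pre_digraph" and u
  proof -
    interpret tournament T by fact
    show ?thesis using pair_no_loops by fastforce
  qed
  have fin: "finite (pverts T)" "finite (parcs T)" if "tournament T" for T :: "'a pair_pre_digraph"
  proof -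
    interpret tournament T by fact
    show "finite (pverts T)" "finite (parcs T)" using pair_finite_verts pair_finite_arcs by auto
  qed
  note one = T[THEN tournament.exactly_one_direction]
  note sub' = T[THEN sub]
  show ?thesis
  proof
    show "fst e \<in> pverts (C3 T\<^sub>1 T\<^sub>2 T\<^sub>3)" if "e \<in> parcs (C3 T\<^sub>1 T\<^sub>2 T\<^sub>3)" for e
      using that sub' by (auto simp: C3_def)
    show "snd e \<in> pverts (C3 T\<^sub>1 T\<^sub>2 T\<^sub>3)" if "e \<in> parcs (C3 T\<^sub>1 T\<^sub>2 T\<^sub>3)" for e
      using that sub' by (auto simp: C3_def)
    show "finite (pverts (C3 T\<^sub>1 T\<^sub>2 T\<^sub>3))" "finite (parcs (C3 T\<^sub>1 T\<^sub>2 T\<^sub>3))"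
      using T[THEN fin(1)] T[THEN fin(2)] by (auto simp: C3_def)
    show "fst e \<noteq> snd e" if "e \<in> parcs (C3 T\<^sub>1 T\<^sub>2 T\<^sub>3)" for e
      using that disj T[THEN loop] by (cases e) (auto simp: C3_def)
    show "(u, v) \<in> parcs (C3 T\<^sub>1 T\<^sub>2 T\<^sub>3) \<longleftrightarrow> (v, u) \<notin> parcs (C3 T\<^sub>1 T\<^sub>2 T\<^sub>3)"
      if uv: "u \<in> pverts (C3 T\<^sub>1 T\<^sub>2 T\<^sub>3)" "v \<in> pverts (C3 T\<^sub>1 T\<^sub>2 T\<^sub>3)" "u \<noteq> v" for u v
    proof -
      have "u \<in> pverts T\<^sub>1 \<or> u \<in> pverts T\<^sub>2 \<or> u \<in> pverts T\<^sub>3" "v \<in> pverts T\<^sub>1 \<or> v \<in> pverts T\<^sub>2 \<or> v \<in> pverts T\<^sub>3"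
        using uv by (auto simp: C3_def)
      then show ?thesis
        using sub' disj one(1)[of u v] one(2)[of u v] one(3)[of u v] \<open>u \<noteq> v\<close>
        unfolding C3_def by (elim disjE) auto
    qed
  qed
qed

lemma card_partition_on_eq_Stirling:
  assumes "finite A"
  shows "card {P. partition_on A P \<and> card P = k} = Stirling (card A) k"
  using assms
proof (induction A arbitrary: k rule: finite_induct)
  case empty
  have "{P. partition_on ({} :: 'a set) P \<and> card P = k} = (if k = 0 then {{}} else {})"
    by (auto simp: partition_on_empty)
  then show ?case by (cases k) (simp_all only: if_True if_False nat.simps card.empty Stirling.simps, simp_all)
next
  case (insert x A)
  define N where "N = (\<lambda>B k. {P. partition_on (B :: 'a set) P \<and> card P = k})"
  have IH: "card (N A k) = Stirling (card A) k" for k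
    using insert.IH by (simp add: N_def)
  have finN: "finite (N A k)" for k
    unfolding N_def using finitely_many_partition_on[OF insert.hyps(1)]
    by (rule rev_finite_subset) auto
  have finP: "finite P" if "partition_on A P" for P
    using finite_elements[OF insert.hyps(1) that] .
  show ?case
  proof (cases k)
    case 0
    have "P = {}" if "partition_on (insert x A) P" "card P = 0" for P
      using that finite_elements[of "insert x A" P] insert.hyps(1) by simp
    then have "{P. partition_on (insert x A) P \<and> card P = 0} = {}"
      by (auto simp: partition_on_def)
    moreover have "card (insert x A) = Suc (card A)" using insert.hyps by simp
    ultimately show ?thesis using 0 by (simp only: card.empty Stirling.simps)
  next
    case (Suc j)
    define f where "f = (\<lambda>(P, B). insert (insert x B) (P - {B}))"
    define S where "S = Sigma (N A (Suc j)) (\<lambda>P. P)"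
    have 1: "{Q \<in> N (insert x A) (Suc j). {x} \<in> Q} = insert {x} ` N A j"
    proof (intro equalityI subsetI)
      fix Q assume Q: "Q \<in> {Q \<in> N (insert x A) (Suc j). {x} \<in> Q}"
      have "partition_on (insert x A) (insert {x} (Q - {{x}}))"
        using Q by (simp add: N_def insert_absorb)
      moreover have "disjnt {x} (\<Union> (Q - {{x}}))"
        using Q by (force simp: N_def partition_on_def disjoint_def disjnt_def)
      ultimately have "partition_on (insert x A - {x}) (Q - {{x}})"
        using partition_on_insert by blast
      then have "partition_on A (Q - {{x}})"
        using insert.hyps(2) by simp
      moreover have "card (Q - {{x}}) = j"
        using Q by (auto simp: N_def)
      ultimately show "Q \<in> insert {x} ` N A j"
        using Q by (auto simp: N_def intro!: image_eqI[of _ _ "Q - {{x}}"])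
    next
      fix Q assume "Q \<in> insert {x} ` N A j"
      then obtain P where P: "partition_on A P" "card P = j" "Q = insert {x} P"
        by (auto simp: N_def)
      have "x \<notin> \<Union>P" using P(1) insert.hyps(2) by (simp add: partition_on_def)
      then have "{x} \<notin> P" "disjnt {x} (\<Union>P)" by (auto simp: disjnt_def)
      then show "Q \<in> {Q \<in> N (insert x A) (Suc j). {x} \<in> Q}"
        using P insert.hyps(2) finP by (simp add: N_def partition_on_insert)
    qed
    have 2: "bij_betw f S {Q \<in> N (insert x A) (Suc j). {x} \<notin> Q}"
    proof (rule bij_betw_byWitness[where f' = "\<lambda>Q. ((\<lambda>C. C - {x}) ` Q, \<Union>{C \<in> Q. x \<in> C} - {x})"])
      have *: "(\<lambda>C. C - {x}) ` f (P, B) = P \<and> \<Union>{C \<in> f (P, B). x \<in> C} - {x} = B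
          \<and> f (P, B) \<in> N (insert x A) (Suc j) \<and> {x} \<notin> f (P, B)"
        if "(P, B) \<in> S" for P B
      proof -
        have P: "partition_on A P" "card P = Suc j" "B \<in> P" using that by (auto simp: S_def N_def)
        have x: "x \<notin> C" if "C \<in> P" for C
          using that P(1) insert.hyps(2) by (auto simp: partition_on_def)
        have "(\<lambda>C. C - {x}) ` (P - {B}) = P - {B}"
          using x by force
        then have a: "(\<lambda>C. C - {x}) ` f (P, B) = P"
          using x[OF P(3)] P(3) by (auto simp: f_def)
        have "{C \<in> f (P, B). x \<in> C} = {insert x B}"
          using x by (auto simp: f_def)
        then have b: "\<Union>{C \<in> f (P, B). x \<in> C} - {x} = B"
          using x[OF P(3)] by simp
        have "insert x B \<notin> P - {B}" using x by blast
        then have c: "card (f (P, B)) = Suc j"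
          using P finP[OF P(1)] by (simp add: f_def)
        have "\<Union>(f (P, B)) = insert x A"
          using P by (auto simp: f_def partition_on_def)
        moreover have "disjoint (f (P, B))"
          using P x unfolding f_def partition_on_def disjoint_def by (auto; blast)
        moreover have "{} \<notin> f (P, B)"
          using P by (auto simp: f_def partition_on_def)
        moreover have "{x} \<notin> f (P, B)"
        proof -
          have "B \<noteq> {}" using P(1,3) by (auto simp: partition_on_def)
          then have "insert x B \<noteq> {x}" using x[OF P(3)] by blast
          then show ?thesis using x by (auto simp: f_def)
        qed
        ultimately show ?thesis
          using a b c by (auto simp: N_def partition_on_def)
      qed
      show "\<forall>a\<in>S. ((\<lambda>C. C - {x}) ` f a, \<Union>{C \<in> f a. x \<in> C} - {x}) = a"
      proof
        fix a assume "a \<in> S"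
        then show "((\<lambda>C. C - {x}) ` f a, \<Union>{C \<in> f a. x \<in> C} - {x}) = a"
          using *[of "fst a" "snd a"] by (simp add: prod_eq_iff)
      qed
      show "f ` S \<subseteq> {Q \<in> N (insert x A) (Suc j). {x} \<notin> Q}"
      proof
        fix Q assume "Q \<in> f ` S"
        then obtain a where "a \<in> S" "Q = f a" by blast
        then show "Q \<in> {Q \<in> N (insert x A) (Suc j). {x} \<notin> Q}"
          using *[of "fst a" "snd a"] by simp
      qed
      have **: "f ((\<lambda>C. C - {x}) ` Q, \<Union>{C \<in> Q. x \<in> C} - {x}) = Q
          \<and> ((\<lambda>C. C - {x}) ` Q, \<Union>{C \<in> Q. x \<in> C} - {x}) \<in> S"
        if "Q \<in> N (insert x A) (Suc j)" "{x} \<notin> Q" for Q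
      proof -
        have Q: "\<Union>Q = insert x A" "disjoint Q" "{} \<notin> Q" "card Q = Suc j"
          using that by (auto simp: N_def partition_on_def)
        obtain D where D: "D \<in> Q" "x \<in> D" using Q(1) by blast
        have uniq: "C = D" if "C \<in> Q" "y \<in> C" "y \<in> D" for C y
          using Q(2) D that by (auto simp: disjoint_def)
        have x: "x \<notin> C" if "C \<in> Q - {D}" for C
          using uniq[of C x] D that by auto
        have DX: "{C \<in> Q. x \<in> C} = {D}" using x D by auto
        have "(\<lambda>C. C - {x}) ` (Q - {D}) = Q - {D}"
          using x by force
        moreover have "Q = insert D (Q - {D})" using D by auto
        ultimately have im: "(\<lambda>C. C - {x}) ` Q = insert (D - {x}) (Q - {D})"
          by (metis image_insert)
        have ne: "D - {x} \<noteq> {}" using D that(2) by (auto simp: subset_singleton_iff)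
        then have new: "D - {x} \<notin> Q"
          using uniq[of "D - {x}"] D by blast
        have "D - {x} \<notin> Q - {D}" using new by blast
        then have feq: "f (insert (D - {x}) (Q - {D}), D - {x}) = Q"
          using D by (simp add: f_def insert_absorb)
        have card: "card (insert (D - {x}) (Q - {D})) = Suc j"
          using new D Q(4) card.infinite[of Q] by (subst card_insert_disjoint) (auto intro: card_ge_0_finite)
        have "\<Union>(insert (D - {x}) (Q - {D})) = \<Union>((\<lambda>C. C - {x}) ` Q)"
          by (simp only: im)
        also have "\<dots> = \<Union>Q - {x}" by auto
        also have "\<dots> = A" using Q(1) insert.hyps(2) by auto
        finally have "\<Union>(insert (D - {x}) (Q - {D})) = A" .
        moreover have "disjoint (insert (D - {x}) (Q - {D}))"
        proof -
          have "disjoint (Q - {D})" using Q(2) by (rule pairwise_subset) blast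
          moreover have "disjnt (D - {x}) C \<and> disjnt C (D - {x})" if "C \<in> Q - {D}" for C
            using uniq[of C] that by (auto simp: disjnt_iff)
          ultimately show ?thesis by (simp add: pairwise_insert)
        qed
        ultimately have "partition_on A (insert (D - {x}) (Q - {D}))"
          using Q(3) ne by (auto simp: partition_on_def)
        then show ?thesis
          using feq card by (simp add: im DX S_def N_def)
      qed
      show "\<forall>Q\<in>{Q \<in> N (insert x A) (Suc j). {x} \<notin> Q}.
          f ((\<lambda>C. C - {x}) ` Q, \<Union>{C \<in> Q. x \<in> C} - {x}) = Q"
        using ** by blast
      show "(\<lambda>Q. ((\<lambda>C. C - {x}) ` Q, \<Union>{C \<in> Q. x \<in> C} - {x})) `
          {Q \<in> N (insert x A) (Suc j). {x} \<notin> Q} \<subseteq> S"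
        using ** by blast
    qed
    have "inj_on (insert {x}) (N A j)"
    proof (rule inj_onI)
      fix P Q assume PQ: "P \<in> N A j" "Q \<in> N A j" "insert {x} P = insert {x} Q"
      have "{x} \<notin> P" "{x} \<notin> Q"
        using PQ(1,2) insert.hyps(2) by (auto simp: N_def partition_on_def)
      then show "P = Q" using PQ(3) by (metis insert_ident)
    qed
    then have c1: "card {Q \<in> N (insert x A) (Suc j). {x} \<in> Q} = Stirling (card A) j"
      unfolding 1 using IH by (simp add: card_image)
    have "card S = (\<Sum>P\<in>N A (Suc j). card P)"
      unfolding S_def using finN finP by (subst card_SigmaI) (auto simp: N_def)
    also have "\<dots> = Suc j * Stirling (card A) (Suc j)"
      using IH[of "Suc j"] by (simp add: N_def)
    finally have c2: "card {Q \<in> N (insert x A) (Suc j). {x} \<notin> Q} = Suc j * Stirling (card A) (Suc j)"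
      using bij_betw_same_card[OF 2] by simp
    have "finite (N (insert x A) (Suc j))"
      unfolding N_def using finitely_many_partition_on[of "insert x A"] insert.hyps(1)
      by (auto intro: rev_finite_subset)
    then have "card (N (insert x A) (Suc j)) =
        card {Q \<in> N (insert x A) (Suc j). {x} \<in> Q} + card {Q \<in> N (insert x A) (Suc j). {x} \<notin> Q}"
      by (subst card_Un_disjoint[symmetric]) (auto intro: arg_cong[where f = card])
    also have "\<dots> = Stirling (card (insert x A)) (Suc j)"
      unfolding c1 c2 using insert.hyps by simp
    finally show ?thesis
      unfolding N_def Suc .
  qed
qed

end

theory Submission
  imports Defs "HOL-Combinatorics.Multiset_Permutations"
begin

text \<open>
  A Hamilton cycle that crosses from \<open>T\<^sub>3\<close> to \<open>T\<^sub>1\<close> exactly \<open>k\<close> times restricts to a cover of each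
  \<open>T\<^sub>i\<close> by \<open>k\<close> vertex-disjoint paths.  Marking one of its \<open>k\<close> crossing arcs and cutting there turns
  the cycle into a vertex listing, which is the interleaving of three ordered path covers with \<open>k\<close>
  paths each, and every such triple arises exactly once.  Hence \<open>k\<close> times the number of these cycles
  is the product of the numbers of ordered path covers.  Sending each path to its vertex set maps
  ordered path covers of \<open>T\<^sub>i\<close> onto ordered set partitions, of which there are \<open>k! S(m\<^sub>i, k)\<close>:
  surjectivity is Redei's theorem that every tournament has a Hamilton path, and the map is
  injective if \<open>T\<^sub>i\<close> is transitive, since then the Hamilton path is unique.
\<close>

section \<open>Closed vertex listings and their arcs\<close>

abbreviation path_in :: "('a \<times> 'a) set \<Rightarrow> 'a list \<Rightarrow> bool" where
  "path_in A \<equiv> successively (\<lambda>u v. (u, v) \<in> A)"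

text \<open>The target \<open>z\<close> of the last arc is a parameter so that arc lists of
  consecutive segments concatenate. Choosing \<open>z\<close> as the head closes the listing
  up.\<close>

fun arcs_to :: "'a list \<Rightarrow> 'a \<Rightarrow> ('a \<times> 'a) list" where
  "arcs_to [] z = []"
| "arcs_to (x # xs) z = (x, hd (xs @ [z])) # arcs_to xs z"

definition closed_arcs :: "'a list \<Rightarrow> ('a \<times> 'a) set" where
  "closed_arcs xs = set (arcs_to xs (hd xs))"

lemma arcs_to_append: "arcs_to (xs @ ys) z = arcs_to xs (hd (ys @ [z])) @ arcs_to ys z"
  by (induction xs) (auto simp: hd_append)

lemma map_fst_arcs_to [simp]: "map fst (arcs_to xs z) = xs"
  by (induction xs) auto

lemma map_snd_arcs_to: "map snd (arcs_to xs z) = tl (xs @ [z])"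
  by (induction xs) (auto simp: neq_Nil_conv hd_append tl_append split: list.splits)

lemma fst_set_arcs_to: "fst ` set (arcs_to xs z) = set xs"
  by (metis list.set_map map_fst_arcs_to)

lemma snd_set_arcs_to: "snd ` set (arcs_to xs z) \<subseteq> set (tl xs @ [z])"
proof -
  have "snd ` set (arcs_to xs z) = set (tl (xs @ [z]))"
    by (metis list.set_map map_snd_arcs_to)
  then show ?thesis by (cases xs) auto
qed

lemma distinct_arcs_to: "distinct xs \<Longrightarrow> distinct (arcs_to xs z)"
  by (metis distinct_map map_fst_arcs_to)

lemma arcs_to_subset_iff: "set (arcs_to xs z) \<subseteq> A \<longleftrightarrow> path_in A (xs @ [z])"
proof (induction xs)
  case (Cons x xs)
  then show ?case by (cases xs) auto
qed simp

lemma closed_arcs_subset_iff: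
  assumes "xs \<noteq> []"
  shows "closed_arcs xs \<subseteq> A \<longleftrightarrow> path_in A xs \<and> (last xs, hd xs) \<in> A"
  using assms by (simp add: closed_arcs_def arcs_to_subset_iff successively_append_iff)

lemma finite_closed_arcs [simp]: "finite (closed_arcs xs)"
  by (simp add: closed_arcs_def)

lemma closed_arcs_append_commute: "closed_arcs (xs @ ys) = closed_arcs (ys @ xs)"
proof (cases "xs = [] \<or> ys = []")
  case False
  then show ?thesis by (auto simp: closed_arcs_def arcs_to_append hd_append)
qed auto

lemma in_arcs_toE:
  assumes "(u, v) \<in> set (arcs_to xs z)"
  obtains as bs where "xs = as @ u # bs" "v = hd (bs @ [z])"
  using assms
proof (induction xs arbitrary: thesis)
  case (Cons x xs)
  show ?case
  proof (cases "(u, v) = (x, hd (xs @ [z]))")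
    case True
    then show ?thesis using Cons.prems(1)[of "[]" xs] by simp
  next
    case False
    then have "(u, v) \<in> set (arcs_to xs z)" using Cons.prems(2) by auto
    then obtain as bs where "xs = as @ u # bs" "v = hd (bs @ [z])"
      using Cons.IH by blast
    then show ?thesis using Cons.prems(1)[of "x # as" bs] by simp
  qed
qed simp

text \<open>Cutting the cycle right behind \<open>u\<close> turns the chosen arc into the closing
  one. The multiset equation later carries distinctness and the vertex set over to the rotated
  listing.\<close>

lemma rotate_to_arc:
  assumes "(u, v) \<in> closed_arcs xs"
  obtains ys where "ys \<noteq> []" "hd ys = v" "last ys = u" "mset ys = mset xs"
    "closed_arcs ys = closed_arcs xs"
proof -
  obtain as bs where ab: "xs = as @ u # bs" "v = hd (bs @ [hd xs])"
    using assms unfolding closed_arcs_def by (rule in_arcs_toE)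
  show thesis
  proof (rule that)
    \<comment> \<open>If \<open>bs\<close> is empty, then \<open>u\<close> is the last vertex of
      \<open>xs\<close> and \<open>v\<close> is its head, which is also the head of
      \<open>as @ [u]\<close>.\<close>
    show "hd (bs @ as @ [u]) = v" using ab by (cases bs; cases as) auto
    show "closed_arcs (bs @ as @ [u]) = closed_arcs xs"
      using ab closed_arcs_append_commute[of "as @ [u]" bs] by simp
  qed (use ab in auto)
qed

text \<open>In a distinct listing each vertex is the source of one arc only, so the arc leaving the
  head determines the next vertex, and so on. Prescribing the head rules out rotations.\<close>

lemma arcs_to_inject:
  assumes "set (arcs_to xs z) = set (arcs_to ys z)" "distinct xs" "distinct ys"
    and "hd (xs @ [z]) = hd (ys @ [z])"
  shows "xs = ys"
  using assms
proof (induction xs arbitrary: ys)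
  case (Cons x xs)
  then obtain y ys' where ys: "ys = y # ys'" by (cases ys) auto
  then have y: "y = x" using Cons.prems by simp
  have nin: "(x, a) \<notin> set (arcs_to us z)" if "x \<notin> set us" for a us
    using that fst_set_arcs_to[of us z] by (metis fst_conv imageI)
  have x: "x \<notin> set xs" "x \<notin> set ys'" using Cons.prems ys y by auto
  have eq: "insert (x, hd (xs @ [z])) (set (arcs_to xs z)) =
      insert (x, hd (ys' @ [z])) (set (arcs_to ys' z))"
    using Cons.prems(1) ys y by simp
  \<comment> \<open>No arc of either tail starts at \<open>x\<close>, so the two inserted arcs must
    coincide.\<close>
  then have hd: "hd (xs @ [z]) = hd (ys' @ [z])" using nin[OF x(1)] nin[OF x(2)] by blast
  then have "set (arcs_to xs z) = set (arcs_to ys' z)"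
    using eq nin[OF x(1)] nin[OF x(2)] by (metis insert_ident)
  then show ?case using Cons.IH[of ys'] Cons.prems ys y hd by simp
next
  case Nil
  then show ?case by (cases ys) auto
qed

lemma closed_arcs_inject:
  assumes "closed_arcs xs = closed_arcs ys" "distinct xs" "distinct ys"
    "xs \<noteq> []" "ys \<noteq> []" "hd xs = hd ys"
  shows "xs = ys"
  using assms arcs_to_inject[of xs "hd xs" ys] by (simp add: closed_arcs_def)

section \<open>Directed cycles of the graph library as closed vertex listings\<close>

lemma pcas_arcs_to: "pcas (hd (xs @ [v])) (arcs_to xs v) v"
  by (induction xs) auto

lemma pcas_imp_arcs_to: "pcas u p v \<Longrightarrow> p = arcs_to (map fst p) v \<and> u = hd (map fst p @ [v])"
proof (induction p arbitrary: u)
  case (Cons e p)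
  then show ?case by (cases e) force
qed simp

lemma pcas_imp_pawalk_verts: "pcas u p v \<Longrightarrow> pawalk_verts u p = u # map snd p"
proof (induction p arbitrary: u)
  case (Cons e p)
  then show ?case by (cases e) force
qed simp

text \<open>A library cycle requires distinct targets. In a closed walk the targets are the sources
  rotated by one place, so this is distinctness of the listing of sources.\<close>

lemma cycle_with_proj_iff:
  assumes "parcs G \<subseteq> pverts G \<times> pverts G"
  shows "pre_digraph.cycle (with_proj G) p \<longleftrightarrow>
    (\<exists>xs. xs \<noteq> [] \<and> distinct xs \<and> p = arcs_to xs (hd xs) \<and> closed_arcs xs \<subseteq> parcs G)"
    (is "?L \<longleftrightarrow> ?R")
proof
  assume ?L
  then obtain u where p: "set p \<subseteq> parcs G" "pcas u p u" "distinct (map snd p)" "p \<noteq> []"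
    by (auto simp: pre_digraph.cycle_def pre_digraph.awalk_def cas_with_proj_eq
        awalk_verts_with_proj_eq pcas_imp_pawalk_verts)
  define xs where "xs = map fst p"
  have xs: "xs \<noteq> []" "p = arcs_to xs (hd xs)" "u = hd xs"
    using pcas_imp_arcs_to[OF p(2)] p(4) by (auto simp: xs_def)
  then have "distinct (tl (xs @ [hd xs]))" using p(3) map_snd_arcs_to by metis
  then have "distinct xs" using xs(1) by (cases xs) auto
  then show ?R using xs p(1) by (auto simp: closed_arcs_def)
next
  assume ?R
  then obtain xs where xs: "xs \<noteq> []" "distinct xs" "p = arcs_to xs (hd xs)" "set p \<subseteq> parcs G"
    by (auto simp: closed_arcs_def)
  have cas: "pcas (hd xs) p (hd xs)" using pcas_arcs_to[of xs "hd xs"] xs by simp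
  have "hd xs \<in> fst ` set p" using xs fst_set_arcs_to by (metis hd_in_set)
  then have "hd xs \<in> pverts G" using xs(4) assms by auto
  moreover have "distinct (map snd p)"
    using xs map_snd_arcs_to[of xs "hd xs"] by (cases xs) auto
  moreover have "p \<noteq> []" using xs by (cases xs) auto
  ultimately show ?L
    using cas xs(4) by (auto simp: pre_digraph.cycle_def pre_digraph.awalk_def cas_with_proj_eq
        awalk_verts_with_proj_eq pcas_imp_pawalk_verts)
qed

lemma hamilton_cycles_eq:
  assumes "parcs G \<subseteq> pverts G \<times> pverts G"
  shows "hamilton_cycles G = closed_arcs `
    {xs. xs \<noteq> [] \<and> distinct xs \<and> set xs = pverts G \<and> closed_arcs xs \<subseteq> parcs G}"
proof (intro equalityI subsetI)
  fix C assume "C \<in> hamilton_cycles G"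
  then show "C \<in> closed_arcs `
      {xs. xs \<noteq> [] \<and> distinct xs \<and> set xs = pverts G \<and> closed_arcs xs \<subseteq> parcs G}"
    unfolding hamilton_cycles_def cycle_with_proj_iff[OF assms]
    by (auto simp: closed_arcs_def fst_set_arcs_to)
next
  fix C assume "C \<in> closed_arcs `
      {xs. xs \<noteq> [] \<and> distinct xs \<and> set xs = pverts G \<and> closed_arcs xs \<subseteq> parcs G}"
  then obtain xs where xs: "C = closed_arcs xs" "xs \<noteq> []" "distinct xs" "set xs = pverts G"
    "closed_arcs xs \<subseteq> parcs G" by blast
  then show "C \<in> hamilton_cycles G"
    unfolding hamilton_cycles_def mem_Collect_eq cycle_with_proj_iff[OF assms]
    by (intro exI[of _ "arcs_to xs (hd xs)"]) (auto simp: closed_arcs_def fst_set_arcs_to)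
qed

text \<open>If no arc entered \<open>X\<close>, a vertex whose successor lies in \<open>X\<close>
  would lie in \<open>X\<close> too. Going backwards around the cycle from \<open>u\<close>, this
  would put every vertex, including \<open>v\<close>, into \<open>X\<close>.\<close>

lemma exists_entering_arc:
  assumes "u \<in> set xs" "u \<in> X" "v \<in> set xs" "v \<notin> X"
  shows "\<exists>a b. (a, b) \<in> closed_arcs xs \<and> a \<notin> X \<and> b \<in> X"
proof (rule ccontr)
  assume contra: "\<not> ?thesis"
  obtain as bs where ab: "xs = as @ u # bs" using assms(1) by (meson split_list)
  have eq: "closed_arcs xs = closed_arcs (u # bs @ as)"
    using closed_arcs_append_commute[of as "u # bs"] ab by simp
  have "set ys \<subseteq> X" if "set (arcs_to ys z) \<subseteq> closed_arcs xs" "z \<in> X" for ys z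
    using that
  proof (induction ys)
    case (Cons y ys)
    then have "set ys \<subseteq> X" by simp
    then have "hd (ys @ [z]) \<in> X" using Cons.prems by (cases ys) auto
    then show ?case using Cons.prems contra \<open>set ys \<subseteq> X\<close> by auto
  qed simp
  moreover have "set (arcs_to (u # bs @ as) u) = closed_arcs xs"
    unfolding eq by (simp add: closed_arcs_def)
  ultimately have "set (u # bs @ as) \<subseteq> X" using assms(2) by blast
  then have "set xs \<subseteq> X" using ab by auto
  then show False using assms by blast
qed

section \<open>Hamilton paths in tournaments\<close>

text \<open>The vertex \<open>x\<close> is inserted before the first vertex to which it has an arc.
  The clause on \<open>hd ys\<close> carries the induction: \<open>y\<close> can be put in front
  because it has an arc both to \<open>x\<close> and to the old next vertex.\<close>

lemma path_in_insert:
  assumes "\<And>u v. u \<in> V \<Longrightarrow> v \<in> V \<Longrightarrow> u \<noteq> v \<Longrightarrow> (u, v) \<in> A \<or> (v, u) \<in> A"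
    and "path_in A xs" "distinct xs" "set xs \<subseteq> V" "x \<in> V" "x \<notin> set xs"
  shows "\<exists>ys. path_in A ys \<and> distinct ys \<and> set ys = insert x (set xs) \<and>
    (hd ys = x \<or> xs \<noteq> [] \<and> hd ys = hd xs)"
  using assms(2-)
proof (induction xs)
  case Nil
  then show ?case by (intro exI[of _ "[x]"]) simp
next
  case (Cons y zs)
  show ?case
  proof (cases "(x, y) \<in> A")
    case True
    then show ?thesis using Cons.prems by (intro exI[of _ "x # y # zs"]) auto
  next
    case False
    then have yx: "(y, x) \<in> A" using assms(1)[of x y] Cons.prems by auto
    obtain ys where ys: "path_in A ys" "distinct ys" "set ys = insert x (set zs)"
      "hd ys = x \<or> zs \<noteq> [] \<and> hd ys = hd zs"
      using Cons by (auto simp: successively_Cons)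
    then have "path_in A (y # ys)"
      using Cons.prems yx by (auto simp: successively_Cons)
    then show ?thesis using ys Cons.prems by (intro exI[of _ "y # ys"]) auto
  qed
qed

text \<open>Redei's theorem, stated for subsets \<open>B\<close> of \<open>V\<close> because it is
  applied to every block of a partition.\<close>

lemma exists_hamilton_path:
  assumes "\<And>u v. u \<in> V \<Longrightarrow> v \<in> V \<Longrightarrow> u \<noteq> v \<Longrightarrow> (u, v) \<in> A \<or> (v, u) \<in> A"
    and "finite B" "B \<subseteq> V"
  shows "\<exists>xs. path_in A xs \<and> distinct xs \<and> set xs = B"
  using assms(2,3)
proof (induction B rule: finite_induct)
  case empty
  then show ?case by (intro exI[of _ "[]"]) simp
next
  case (insert x B)
  then obtain xs where "path_in A xs" "distinct xs" "set xs = B" by auto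
  then show ?case using path_in_insert[OF assms(1), of V xs x] insert by auto
qed

text \<open>The head of a sorted list is related to all other entries, so two different heads would
  be related in both directions.\<close>

lemma sorted_wrt_unique:
  assumes "sorted_wrt R xs" "sorted_wrt R ys" "distinct xs" "distinct ys" "set xs = set ys"
    and "\<And>x y. R x y \<Longrightarrow> \<not> R y x"
  shows "xs = ys"
  using assms(1-5)
proof (induction xs arbitrary: ys)
  case (Cons x xs)
  then obtain y ys' where ys: "ys = y # ys'" by (cases ys) auto
  have "x = y"
  proof (rule ccontr)
    assume "x \<noteq> y"
    then have "R x y" "R y x" using Cons.prems ys by (auto simp: set_eq_iff)
    then show False using assms(6) by blast
  qed
  then show ?case using Cons.IH[of ys'] Cons.prems ys by (auto simp: insert_ident)
qed simp

section \<open>Arcs of tournaments and of transitive tournaments\<close>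

context tournament
begin

lemma parcs_subset: "parcs G \<subseteq> pverts G \<times> pverts G"
  using in_arcsD1 in_arcsD2 by auto

lemma no_loop: "(u, u) \<notin> parcs G"
  using pair_no_loops by fastforce

lemma total: "u \<in> pverts G \<Longrightarrow> v \<in> pverts G \<Longrightarrow> u \<noteq> v \<Longrightarrow> (u, v) \<in> parcs G \<or> (v, u) \<in> parcs G"
  using exactly_one_direction by blast

lemma asym: "(u, v) \<in> parcs G \<Longrightarrow> (v, u) \<notin> parcs G"
  using exactly_one_direction[of u v] no_loop in_arcsD1 in_arcsD2 by metis

end

text \<open>A failure of transitivity at \<open>u\<close>, \<open>v\<close>, \<open>w\<close> means
  that the arc between \<open>u\<close> and \<open>w\<close> points back to \<open>u\<close>, which
  gives a directed triangle.\<close>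

lemma (in transitive_tournament) trans_parcs: "trans (parcs G)"
proof (rule transI, rule ccontr)
  fix u v w assume uvw: "(u, v) \<in> parcs G" "(v, w) \<in> parcs G" "(u, w) \<notin> parcs G"
  then have "u \<noteq> w" using asym by blast
  then have "(w, u) \<in> parcs G"
    using total uvw in_arcsD1 in_arcsD2 by metis
  moreover have "u \<noteq> v" "v \<noteq> w" using uvw no_loop by auto
  ultimately have "pre_digraph.cycle (with_proj G) (arcs_to [u, v, w] u)"
    using uvw \<open>u \<noteq> w\<close> unfolding cycle_with_proj_iff[OF parcs_subset]
    by (intro exI[of _ "[u, v, w]"]) (simp add: closed_arcs_def)
  with no_cycle show False by (rule notE)
qed

section \<open>Ordered path covers\<close>

definition ordered_path_covers :: "'a pair_pre_digraph \<Rightarrow> nat \<Rightarrow> 'a list list set" where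
  "ordered_path_covers G k = {ps. length ps = k \<and> [] \<notin> set ps \<and> distinct (concat ps) \<and>
    set (concat ps) = pverts G \<and> (\<forall>p\<in>set ps. path_in (parcs G) p)}"

definition ordered_partitions :: "'a set \<Rightarrow> nat \<Rightarrow> 'a set list set" where
  "ordered_partitions V k = {Bs. length Bs = k \<and> distinct Bs \<and> partition_on V (set Bs)}"

text \<open>Each partition into \<open>k\<close> blocks has \<open>fact k\<close> enumerations, and
  enumerations of different partitions differ because their underlying sets do.\<close>

lemma card_ordered_partitions:
  assumes "finite V"
  shows "card (ordered_partitions V k) = Stirling (card V) k * fact k"
proof -
  let ?N = "{P. partition_on V P \<and> card P = k}"
  have fin: "finite ?N"
    using finitely_many_partition_on[OF assms] by (rule rev_finite_subset) auto
  have cardP: "card (permutations_of_set P) = fact k" if "P \<in> ?N" for P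
    using that finite_elements[OF assms] card_permutations_of_set[of P] by auto
  have "ordered_partitions V k = (\<Union>P\<in>?N. permutations_of_set P)"
    by (auto simp: ordered_partitions_def permutations_of_set_def distinct_card)
  also have "card \<dots> = (\<Sum>P\<in>?N. card (permutations_of_set P))"
    using fin by (intro card_UN_disjoint) (simp, simp, auto simp: permutations_of_set_def)
  also have "\<dots> = (\<Sum>P\<in>?N. fact k)"
    using cardP by (rule sum.cong[OF refl])
  also have "\<dots> = Stirling (card V) k * fact k"
    by (simp add: card_partition_on_eq_Stirling[OF assms])
  finally show ?thesis .
qed

context tournament
begin

text \<open>Nonempty disjoint paths use at least one vertex each. This is the source of the upper
  summation limit \<open>Min {m\<^sub>1, m\<^sub>2, m\<^sub>3}\<close>.\<close>

lemma length_ordered_path_cover: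
  assumes "ps \<in> ordered_path_covers G k"
  shows "k \<le> card (pverts G)"
proof -
  have "length ps \<le> length (concat ps)" if "[] \<notin> set ps"
    using that
  proof (induction ps)
    case (Cons p ps)
    then show ?case by (cases p) auto
  qed simp
  then show ?thesis
    using assms distinct_card[of "concat ps"] by (auto simp: ordered_path_covers_def)
qed

text \<open>Both the number of paths and their lengths are bounded. Finiteness is what allows the
  cardinality of the image under \<open>map set\<close> to serve as a lower bound.\<close>

lemma finite_ordered_path_covers: "finite (ordered_path_covers G k)"
proof (rule finite_subset)
  let ?P = "{p. set p \<subseteq> pverts G \<and> length p \<le> card (pverts G)}"
  show "finite {ps. set ps \<subseteq> ?P \<and> length ps = k}"
    using pair_finite_verts by (intro finite_lists_length_eq finite_lists_length_le)
  have "length p \<le> card (pverts G)" if "ps \<in> ordered_path_covers G k" "p \<in> set ps" for ps p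
  proof -
    have "distinct p" "set p \<subseteq> pverts G"
      using that by (auto simp: ordered_path_covers_def distinct_concat_iff)
    then show ?thesis by (metis distinct_card card_mono pair_finite_verts)
  qed
  then show "ordered_path_covers G k \<subseteq> {ps. set ps \<subseteq> ?P \<and> length ps = k}"
    by (auto simp: ordered_path_covers_def)
qed

lemma map_set_ordered_path_covers:
  "map set ` ordered_path_covers G k = ordered_partitions (pverts G) k"
proof (intro equalityI subsetI)
  fix Bs assume "Bs \<in> map set ` ordered_path_covers G k"
  then obtain ps where ps: "Bs = map set ps" "length ps = k" "[] \<notin> set ps" "distinct ps"
    "set (concat ps) = pverts G"
    "\<And>p q. p \<in> set ps \<Longrightarrow> q \<in> set ps \<Longrightarrow> p \<noteq> q \<Longrightarrow> set p \<inter> set q = {}"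
    by (auto simp: ordered_path_covers_def distinct_concat_iff removeAll_id)
  \<comment> \<open>Different paths of a cover are disjoint and nonempty, so they cannot have the
    same vertex set.\<close>
  have "inj_on set (set ps)"
    using ps(3,6) by (intro inj_onI) (metis inf.idem set_empty)
  moreover have "partition_on (pverts G) (set Bs)"
    using ps unfolding partition_on_def disjoint_def by (auto; blast)
  ultimately show "Bs \<in> ordered_partitions (pverts G) k"
    using ps by (auto simp: ordered_partitions_def distinct_map)
next
  fix Bs assume "Bs \<in> ordered_partitions (pverts G) k"
  then have Bs: "length Bs = k" "distinct Bs" "partition_on (pverts G) (set Bs)"
    by (auto simp: ordered_partitions_def)
  \<comment> \<open>A preimage is built blockwise by choosing a Hamilton path of each block.\<close>
  have "\<forall>B\<in>set Bs. \<exists>p. path_in (parcs G) p \<and> distinct p \<and> set p = B"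
  proof
    fix B assume "B \<in> set Bs"
    then have "B \<subseteq> pverts G" using Bs(3) by (auto simp: partition_on_def)
    then show "\<exists>p. path_in (parcs G) p \<and> distinct p \<and> set p = B"
      using exists_hamilton_path[OF total] pair_finite_verts finite_subset by metis
  qed
  then obtain h where h: "\<And>B. B \<in> set Bs \<Longrightarrow> path_in (parcs G) (h B) \<and> distinct (h B) \<and> set (h B) = B"
    by metis
  have eq: "map set (map h Bs) = Bs" using h by (simp add: map_idI)
  have "distinct (map h Bs)" using eq Bs(2) by (metis distinct_map)
  moreover have "[] \<notin> set (map h Bs)"
    using h Bs(3) by (auto simp: partition_on_def) (metis set_empty2)
  moreover have "A \<inter> B = {}" if "A \<in> set Bs" "B \<in> set Bs" "A \<noteq> B" for A B
    using Bs(3) that by (auto simp: partition_on_def disjoint_def)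
  ultimately have "distinct (concat (map h Bs))"
    using h unfolding distinct_concat_iff by (auto simp: removeAll_id) (metis disjoint_iff)
  moreover have "set (concat (map h Bs)) = pverts G"
    using h Bs(3) by (auto simp: partition_on_def)
  ultimately have "map h Bs \<in> ordered_path_covers G k"
    using h Bs(1) \<open>[] \<notin> set (map h Bs)\<close> by (auto simp: ordered_path_covers_def)
  then show "Bs \<in> map set ` ordered_path_covers G k"
    using eq by (metis imageI)
qed

lemma card_ordered_path_covers_ge:
  "Stirling (card (pverts G)) k * fact k \<le> card (ordered_path_covers G k)"
  using card_image_le[OF finite_ordered_path_covers, of "map set" k]
  by (simp add: map_set_ordered_path_covers card_ordered_partitions pair_finite_verts)

end

lemma (in transitive_tournament) card_ordered_path_covers:
  "card (ordered_path_covers G k) = Stirling (card (pverts G)) k * fact k"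
proof -
  \<comment> \<open>Injectivity is checked on single paths: for a transitive relation a path is a
    sorted list, hence determined by its vertex set.\<close>
  have "inj_on set (\<Union>(set ` ordered_path_covers G k))"
  proof (rule inj_onI)
    fix p q assume "p \<in> \<Union>(set ` ordered_path_covers G k)" "q \<in> \<Union>(set ` ordered_path_covers G k)"
      and "set p = set q"
    then have "path_in (parcs G) p" "path_in (parcs G) q" "distinct p" "distinct q" "set p = set q"
      by (auto simp: ordered_path_covers_def distinct_concat_iff)
    moreover have "transp (\<lambda>u v. (u, v) \<in> parcs G)"
      using trans_parcs by (auto intro: transpI dest: transD)
    ultimately show "p = q"
      by (intro sorted_wrt_unique[of "\<lambda>u v. (u, v) \<in> parcs G" p q] asym)
        (simp_all add: successively_conv_sorted_wrt)
  qed
  then have "inj_on (map set) (ordered_path_covers G k)" by (rule inj_on_mapI)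
  then have "card (ordered_path_covers G k) = card (map set ` ordered_path_covers G k)"
    by (simp add: card_image)
  then show ?thesis
    by (simp add: map_set_ordered_path_covers card_ordered_partitions pair_finite_verts)
qed

section \<open>Cutting cycles into interleaved path covers\<close>

fun interleave :: "'a list list \<Rightarrow> 'a list list \<Rightarrow> 'a list list \<Rightarrow> 'a list" where
  "interleave (p # ps) (q # qs) (r # rs) = p @ q @ r @ interleave ps qs rs"
| "interleave _ _ _ = []"

lemma mset_interleave:
  assumes "length ps = length qs" "length qs = length rs"
  shows "mset (interleave ps qs rs) = mset (concat ps @ concat qs @ concat rs)"
  using assms by (induction ps qs rs rule: list_induct3) auto

text \<open>Both prefixes are \<open>takeWhile\<close> of membership in \<open>X\<close> on the same
  list. This is why a listing can be cut into blocks in one way only.\<close>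

lemma maximal_prefix_unique:
  assumes "p @ xs = q @ ys" "set p \<subseteq> X" "set q \<subseteq> X"
    and "xs = [] \<or> hd xs \<notin> X" "ys = [] \<or> hd ys \<notin> X"
  shows "p = q" "xs = ys"
proof -
  have "takeWhile (\<lambda>x. x \<in> X) (p @ xs) = p" if "set p \<subseteq> X" "xs = [] \<or> hd xs \<notin> X" for p xs
    using that by (cases xs) (auto simp: takeWhile_append subset_iff)
  then show "p = q" using assms by metis
  then show "xs = ys" using assms(1) by simp
qed

lemma maximal_prefixE:
  assumes "xs \<noteq> []" "hd xs \<in> X"
  obtains p ys where "xs = p @ ys" "p \<noteq> []" "set p \<subseteq> X" "ys = [] \<or> hd ys \<notin> X"
proof
  show "xs = takeWhile (\<lambda>x. x \<in> X) xs @ dropWhile (\<lambda>x. x \<in> X) xs" by simp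
  show "takeWhile (\<lambda>x. x \<in> X) xs \<noteq> []" using assms by (cases xs) auto
  show "set (takeWhile (\<lambda>x. x \<in> X) xs) \<subseteq> X" by (auto dest: set_takeWhileD)
  show "dropWhile (\<lambda>x. x \<in> X) xs = [] \<or> hd (dropWhile (\<lambda>x. x \<in> X) xs) \<notin> X"
    using hd_dropWhile[of "\<lambda>x. x \<in> X" xs] by blast
qed

definition paths_within :: "'a set \<Rightarrow> ('a \<times> 'a) set \<Rightarrow> 'a list list \<Rightarrow> bool" where
  "paths_within X A ps \<longleftrightarrow> (\<forall>p\<in>set ps. p \<noteq> [] \<and> set p \<subseteq> X \<and> path_in A p)"

lemma paths_within_simps [simp]:
  "paths_within X A []"
  "paths_within X A (p # ps) \<longleftrightarrow> p \<noteq> [] \<and> set p \<subseteq> X \<and> path_in A p \<and> paths_within X A ps"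
  by (auto simp: paths_within_def)

lemma filter_arcs_to_eq_Nil:
  assumes "set xs \<inter> X = {} \<or> (set (tl xs) \<inter> Y = {} \<and> z \<notin> Y)"
  shows "filter (\<lambda>e. e \<in> X \<times> Y) (arcs_to xs z) = []"
proof -
  have "e \<notin> X \<times> Y" if "e \<in> set (arcs_to xs z)" for e
  proof -
    have "fst e \<in> set xs" "snd e \<in> set (tl xs @ [z])"
      using that fst_set_arcs_to[of xs z] snd_set_arcs_to[of xs z] by auto
    then show ?thesis using assms by (cases e) auto
  qed
  then show ?thesis by (simp add: filter_empty_conv)
qed

text \<open>Arcs inside the block have targets in \<open>X\<close>, hence outside \<open>Y\<close>;
  only the final arc, to \<open>z\<close>, leads into \<open>Y\<close>.\<close>

lemma filter_arcs_to_last: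
  assumes "xs \<noteq> []" "set xs \<subseteq> X" "set xs \<inter> Y = {}" "z \<in> Y"
  shows "length (filter (\<lambda>e. e \<in> X \<times> Y) (arcs_to xs z)) = 1"
proof -
  obtain ys y where xs: "xs = ys @ [y]" using assms(1) by (metis rev_exhaust)
  have "filter (\<lambda>e. e \<in> X \<times> Y) (arcs_to ys y) = []"
    using assms xs by (intro filter_arcs_to_eq_Nil) (cases ys; auto)
  then show ?thesis using assms xs by (simp add: arcs_to_append)
qed

text \<open>Only arcs between different parts are prescribed, and arcs inside a part are arbitrary.
  The cutting argument can thus be carried out for one arc set \<open>A\<close>, without reference
  to three tournaments.\<close>

locale cyclic_triple =
  fixes V\<^sub>1 V\<^sub>2 V\<^sub>3 :: "'a set" and A :: "('a \<times> 'a) set"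
  assumes finite: "finite V\<^sub>1" "finite V\<^sub>2" "finite V\<^sub>3"
    and disjoint: "V\<^sub>1 \<inter> V\<^sub>2 = {}" "V\<^sub>2 \<inter> V\<^sub>3 = {}" "V\<^sub>1 \<inter> V\<^sub>3 = {}"
    and within: "A \<subseteq> (V\<^sub>1 \<union> V\<^sub>2 \<union> V\<^sub>3) \<times> (V\<^sub>1 \<union> V\<^sub>2 \<union> V\<^sub>3)"
    and forward: "V\<^sub>1 \<times> V\<^sub>2 \<subseteq> A" "V\<^sub>2 \<times> V\<^sub>3 \<subseteq> A" "V\<^sub>3 \<times> V\<^sub>1 \<subseteq> A"
    and no_backward: "A \<inter> V\<^sub>2 \<times> V\<^sub>1 = {}" "A \<inter> V\<^sub>3 \<times> V\<^sub>2 = {}" "A \<inter> V\<^sub>1 \<times> V\<^sub>3 = {}"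
begin

section \<open>Cycles of a cyclic triple and their marked crossings\<close>

definition covers :: "'a set \<Rightarrow> nat \<Rightarrow> 'a list list set" where
  "covers X k = {ps. length ps = k \<and> paths_within X A ps \<and> distinct (concat ps) \<and> set (concat ps) = X}"

definition cycles :: "('a \<times> 'a) set set" where
  "cycles = closed_arcs `
    {xs. xs \<noteq> [] \<and> distinct xs \<and> set xs = V\<^sub>1 \<union> V\<^sub>2 \<union> V\<^sub>3 \<and> closed_arcs xs \<subseteq> A}"

definition crossings :: "('a \<times> 'a) set \<Rightarrow> ('a \<times> 'a) set" where
  "crossings C = C \<inter> V\<^sub>3 \<times> V\<^sub>1"

text \<open>These are the cycles cut open at a marked crossing. The closing arc from
  \<open>last xs\<close> to \<open>hd xs\<close> lies in
  \<open>V\<^sub>3 \<times> V\<^sub>1\<close>, hence in \<open>A\<close> by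
  \<open>forward\<close>.\<close>

definition listings :: "nat \<Rightarrow> 'a list set" where
  "listings k = {xs. xs \<noteq> [] \<and> distinct xs \<and> set xs = V\<^sub>1 \<union> V\<^sub>2 \<union> V\<^sub>3 \<and> path_in A xs \<and>
    hd xs \<in> V\<^sub>1 \<and> last xs \<in> V\<^sub>3 \<and> card (crossings (closed_arcs xs)) = k}"

lemma finite_cycles: "finite cycles"
proof (rule finite_subset)
  show "cycles \<subseteq> Pow ((V\<^sub>1 \<union> V\<^sub>2 \<union> V\<^sub>3) \<times> (V\<^sub>1 \<union> V\<^sub>2 \<union> V\<^sub>3))"
    using within unfolding cycles_def by blast
qed (simp add: finite)

text \<open>A listing corresponds to its cycle together with its closing arc as the mark, and a
  cycle with \<open>k\<close> crossings can be marked in \<open>k\<close> ways.\<close>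

lemma card_listings: "card (listings k) = k * card {C \<in> cycles. card (crossings C) = k}"
proof -
  let ?M = "Sigma {C \<in> cycles. card (crossings C) = k} crossings"
  let ?f = "\<lambda>xs. (closed_arcs xs, (last xs, hd xs))"
  have "bij_betw ?f (listings k) ?M"
    unfolding bij_betw_def
  proof (intro conjI equalityI subsetI)
    show "inj_on ?f (listings k)"
      by (rule inj_onI) (auto simp: listings_def intro: closed_arcs_inject)
  next
    fix m assume "m \<in> ?f ` listings k"
    then obtain xs where xs: "m = ?f xs" "xs \<in> listings k" by blast
    have l: "xs \<noteq> []" "distinct xs" "set xs = V\<^sub>1 \<union> V\<^sub>2 \<union> V\<^sub>3" "path_in A xs"
      "hd xs \<in> V\<^sub>1" "last xs \<in> V\<^sub>3" "card (crossings (closed_arcs xs)) = k"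
      using xs(2) by (auto simp: listings_def)
    then have "(last xs, hd xs) \<in> A" using forward by blast
    then have "closed_arcs xs \<subseteq> A" using closed_arcs_subset_iff l by blast
    \<comment> \<open>Taking \<open>closed_arcs xs\<close> itself as the superset makes the left
      side of the equivalence trivial.\<close>
    moreover have "(last xs, hd xs) \<in> closed_arcs xs"
      using closed_arcs_subset_iff[OF l(1), of "closed_arcs xs"] by blast
    ultimately show "m \<in> ?M"
      using l xs(1) by (auto simp: cycles_def crossings_def)
  next
    fix m assume "m \<in> ?M"
    then obtain xs u v where m: "m = (closed_arcs xs, (u, v))" "(u, v) \<in> closed_arcs xs"
      "u \<in> V\<^sub>3" "v \<in> V\<^sub>1" "distinct xs" "set xs = V\<^sub>1 \<union> V\<^sub>2 \<union> V\<^sub>3" "closed_arcs xs \<subseteq> A"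
      "card (crossings (closed_arcs xs)) = k"
      by (auto simp: cycles_def crossings_def)
    obtain ys where ys: "ys \<noteq> []" "hd ys = v" "last ys = u" "mset ys = mset xs"
      "closed_arcs ys = closed_arcs xs"
      using m(2) by (rule rotate_to_arc)
    have "distinct ys" "set ys = set xs"
      using ys(4) m(5) mset_eq_imp_distinct_iff mset_eq_setD by metis+
    moreover have "path_in A ys" using closed_arcs_subset_iff[OF ys(1), of A] ys(5) m(7) by simp
    ultimately have "ys \<in> listings k" using m ys by (simp add: listings_def)
    then show "m \<in> ?f ` listings k" using m(1) ys by (intro image_eqI[of _ _ ys]) auto
  qed
  then have "card (listings k) = card ?M" by (rule bij_betw_same_card)
  also have "\<dots> = (\<Sum>C\<in>{C \<in> cycles. card (crossings C) = k}. card (crossings C))"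
    using finite finite_cycles by (intro card_SigmaI) (auto simp: crossings_def)
  finally show ?thesis by simp
qed

text \<open>Each round of three blocks has exactly one arc from \<open>V\<^sub>3\<close> to
  \<open>V\<^sub>1\<close>, the one leaving its third block. The target \<open>z\<close> is
  arbitrary in \<open>V\<^sub>1\<close> so that the count passes to the remaining rounds; it is
  later the head of the listing.\<close>

lemma interleave_props:
  assumes "length ps = length qs" "length qs = length rs"
    and "paths_within V\<^sub>1 A ps" "paths_within V\<^sub>2 A qs" "paths_within V\<^sub>3 A rs"
  shows "path_in A (interleave ps qs rs)"
    and "ps \<noteq> [] \<Longrightarrow> interleave ps qs rs \<noteq> [] \<and>
      hd (interleave ps qs rs) \<in> V\<^sub>1 \<and> last (interleave ps qs rs) \<in> V\<^sub>3"
    and "z \<in> V\<^sub>1 \<Longrightarrow>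
      length (filter (\<lambda>e. e \<in> V\<^sub>3 \<times> V\<^sub>1) (arcs_to (interleave ps qs rs) z)) = length ps"
proof -
  have hd_in: "interleave ps qs rs = [] \<or> hd (interleave ps qs rs) \<in> V\<^sub>1"
    if "paths_within V\<^sub>1 A ps" for ps qs rs
    using that by (cases "(ps, qs, rs)" rule: interleave.cases) (auto simp: hd_append)
  have "path_in A (interleave ps qs rs) \<and>
    (ps \<noteq> [] \<longrightarrow> interleave ps qs rs \<noteq> [] \<and> hd (interleave ps qs rs) \<in> V\<^sub>1 \<and>
      last (interleave ps qs rs) \<in> V\<^sub>3) \<and>
    (z \<in> V\<^sub>1 \<longrightarrow>
      length (filter (\<lambda>e. e \<in> V\<^sub>3 \<times> V\<^sub>1) (arcs_to (interleave ps qs rs) z)) = length ps)"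
    using assms
  proof (induction ps qs rs rule: list_induct3)
    case (Cons p ps q qs r rs)
    define R where "R = interleave ps qs rs"
    have p: "p \<noteq> []" "set p \<subseteq> V\<^sub>1" "path_in A p" and q: "q \<noteq> []" "set q \<subseteq> V\<^sub>2" "path_in A q"
      and r: "r \<noteq> []" "set r \<subseteq> V\<^sub>3" "path_in A r"
      using Cons by auto
    have ends: "hd p \<in> V\<^sub>1" "last p \<in> V\<^sub>1" "hd q \<in> V\<^sub>2" "last q \<in> V\<^sub>2" "hd r \<in> V\<^sub>3" "last r \<in> V\<^sub>3"
      using p q r hd_in_set last_in_set by blast+
    have IH: "path_in A R" "ps \<noteq> [] \<Longrightarrow> last R \<in> V\<^sub>3"
      "z \<in> V\<^sub>1 \<Longrightarrow> length (filter (\<lambda>e. e \<in> V\<^sub>3 \<times> V\<^sub>1) (arcs_to R z)) = length ps"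
      using Cons by (auto simp: R_def)
    have R: "R = [] \<or> hd R \<in> V\<^sub>1" using hd_in Cons by (auto simp: R_def)
    have RN: "R = []" if "ps = []" using that by (simp add: R_def)
    have "path_in A (p @ q @ r @ R)"
      using p q r IH(1) R ends forward by (auto simp: successively_append_iff)
    moreover have "last (p @ q @ r @ R) \<in> V\<^sub>3"
      using IH(2) RN ends r(1) by (auto simp: last_append)
    moreover have "length (filter (\<lambda>e. e \<in> V\<^sub>3 \<times> V\<^sub>1) (arcs_to (p @ q @ r @ R) z)) = Suc (length ps)"
      if z: "z \<in> V\<^sub>1"
    proof -
      have eq: "arcs_to (p @ q @ r @ R) z =
          arcs_to p (hd q) @ arcs_to q (hd r) @ arcs_to r (hd (R @ [z])) @ arcs_to R z"
        using q(1) r(1) by (simp add: arcs_to_append)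
      have "hd (R @ [z]) \<in> V\<^sub>1" using R z by (auto simp: hd_append)
      then have "length (filter (\<lambda>e. e \<in> V\<^sub>3 \<times> V\<^sub>1) (arcs_to r (hd (R @ [z])))) = 1"
        using r disjoint by (intro filter_arcs_to_last) auto
      moreover have "filter (\<lambda>e. e \<in> V\<^sub>3 \<times> V\<^sub>1) (arcs_to p (hd q)) = []"
        "filter (\<lambda>e. e \<in> V\<^sub>3 \<times> V\<^sub>1) (arcs_to q (hd r)) = []"
        using p q disjoint by (auto intro!: filter_arcs_to_eq_Nil simp del: filter_empty_conv)
      ultimately show ?thesis unfolding eq using IH(3)[OF z] by simp
    qed
    ultimately show ?case using p(1) ends by (simp add: R_def)
  qed auto
  then show "path_in A (interleave ps qs rs)"
    "ps \<noteq> [] \<Longrightarrow> interleave ps qs rs \<noteq> [] \<and>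
      hd (interleave ps qs rs) \<in> V\<^sub>1 \<and> last (interleave ps qs rs) \<in> V\<^sub>3"
    "z \<in> V\<^sub>1 \<Longrightarrow>
      length (filter (\<lambda>e. e \<in> V\<^sub>3 \<times> V\<^sub>1) (arcs_to (interleave ps qs rs) z)) = length ps"
    by blast+
qed

text \<open>Every block is followed by a vertex outside its own part or ends the list, so the blocks
  are recovered one after another as maximal prefixes in \<open>V\<^sub>1\<close>,
  \<open>V\<^sub>2\<close> and \<open>V\<^sub>3\<close>.\<close>

lemma interleave_inject:
  assumes "length ps = length qs" "length qs = length rs"
    and "length ps = length ps'" "length qs = length qs'" "length rs = length rs'"
    and "paths_within V\<^sub>1 A ps" "paths_within V\<^sub>2 A qs" "paths_within V\<^sub>3 A rs"
    and "paths_within V\<^sub>1 A ps'" "paths_within V\<^sub>2 A qs'" "paths_within V\<^sub>3 A rs'"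
    and "interleave ps qs rs = interleave ps' qs' rs'"
  shows "ps = ps' \<and> qs = qs' \<and> rs = rs'"
  using assms
proof (induction ps qs rs arbitrary: ps' qs' rs' rule: list_induct3)
  case (Cons p ps q qs r rs)
  obtain p' q' r' ps'' qs'' rs'' where
    s: "ps' = p' # ps''" "qs' = q' # qs''" "rs' = r' # rs''"
    using Cons.prems(1-3) by (cases ps'; cases qs'; cases rs') auto
  have hd_in: "hd xs \<in> X" if "xs \<noteq> []" "set xs \<subseteq> X" for xs and X :: "'a set"
    using that hd_in_set by blast
  have R: "interleave ps qs rs = [] \<or> hd (interleave ps qs rs) \<in> V\<^sub>1"
    if "paths_within V\<^sub>1 A ps" "length ps = length qs" "length qs = length rs" for ps qs rs
    using that hd_in by (cases "(ps, qs, rs)" rule: interleave.cases) auto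
  have P: "p \<noteq> []" "set p \<subseteq> V\<^sub>1" "p' \<noteq> []" "set p' \<subseteq> V\<^sub>1" "q \<noteq> []" "set q \<subseteq> V\<^sub>2"
    "q' \<noteq> []" "set q' \<subseteq> V\<^sub>2" "r \<noteq> []" "set r \<subseteq> V\<^sub>3" "r' \<noteq> []" "set r' \<subseteq> V\<^sub>3"
    using Cons s by auto
  have "hd q \<in> V\<^sub>2" "hd q' \<in> V\<^sub>2" "hd r \<in> V\<^sub>3" "hd r' \<in> V\<^sub>3" using P hd_in by auto
  then have H: "hd q \<notin> V\<^sub>1" "hd q' \<notin> V\<^sub>1" "hd r \<notin> V\<^sub>2" "hd r' \<notin> V\<^sub>2" using disjoint by auto
  have eq: "p @ q @ r @ interleave ps qs rs = p' @ q' @ r' @ interleave ps'' qs'' rs''"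
    using Cons s by simp
  have 1: "p = p'" "q @ r @ interleave ps qs rs = q' @ r' @ interleave ps'' qs'' rs''"
    using maximal_prefix_unique[OF eq, of V\<^sub>1] P H by auto
  have 2: "q = q'" "r @ interleave ps qs rs = r' @ interleave ps'' qs'' rs''"
    using maximal_prefix_unique[OF 1(2), of V\<^sub>2] P H by auto
  have "interleave ps qs rs = [] \<or> hd (interleave ps qs rs) \<in> V\<^sub>1"
    "interleave ps'' qs'' rs'' = [] \<or> hd (interleave ps'' qs'' rs'') \<in> V\<^sub>1"
    using R[of ps qs rs] R[of ps'' qs'' rs''] Cons.hyps Cons.prems s by simp_all
  then have 3: "r = r'" "interleave ps qs rs = interleave ps'' qs'' rs''"
    using maximal_prefix_unique[OF 2(2), of V\<^sub>3] P disjoint by blast+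
  have "ps = ps'' \<and> qs = qs'' \<and> rs = rs''"
    using Cons.prems s 3(2) by (intro Cons.IH) auto
  then show ?case using s 1 2 3 by simp
qed auto

text \<open>A path leaves \<open>V\<^sub>1\<close> only for \<open>V\<^sub>2\<close>,
  \<open>V\<^sub>2\<close> only for \<open>V\<^sub>3\<close>, and \<open>V\<^sub>3\<close> only for
  \<open>V\<^sub>1\<close>. Removing one maximal run in each part leaves a shorter list that is
  empty or again starts in \<open>V\<^sub>1\<close> and ends in \<open>V\<^sub>3\<close>.\<close>

lemma interleave_surject:
  assumes "path_in A xs" "set xs \<subseteq> V\<^sub>1 \<union> V\<^sub>2 \<union> V\<^sub>3"
    and "xs = [] \<or> hd xs \<in> V\<^sub>1 \<and> last xs \<in> V\<^sub>3"
  shows "\<exists>ps qs rs. length ps = length qs \<and> length qs = length rs \<and>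
    paths_within V\<^sub>1 A ps \<and> paths_within V\<^sub>2 A qs \<and> paths_within V\<^sub>3 A rs \<and>
    interleave ps qs rs = xs"
  using assms
proof (induction xs rule: length_induct)
  case (1 xs)
  show ?case
  proof (cases "xs = []")
    case True
    then show ?thesis by (intro exI[of _ "[]"]) simp
  next
    case False
    then have xs: "hd xs \<in> V\<^sub>1" "last xs \<in> V\<^sub>3" using 1 by auto
    \<comment> \<open>A run inside \<open>X\<close> cannot exhaust the list, whose last vertex lies
      in \<open>V\<^sub>3\<close>, so there is an exit arc. It is used for the runs in
      \<open>V\<^sub>1\<close> and \<open>V\<^sub>2\<close>; a run in \<open>V\<^sub>3\<close> may
      end the list.\<close>
    have next_hd: "ys \<noteq> [] \<and> hd ys \<in> Y"
      if "zs = p @ ys" "p \<noteq> []" "set p \<subseteq> X" "ys = [] \<or> hd ys \<notin> X" "last zs \<in> V\<^sub>3" "path_in A zs"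
        "set zs \<subseteq> V\<^sub>1 \<union> V\<^sub>2 \<union> V\<^sub>3" "X \<inter> V\<^sub>3 = {}" "A \<inter> X \<times> (V\<^sub>1 \<union> V\<^sub>2 \<union> V\<^sub>3 - X) \<subseteq> UNIV \<times> Y"
      for zs p ys X Y
    proof -
      have p: "last p \<in> X" using that last_in_set by blast
      then have ne: "ys \<noteq> []" using that by auto
      then have "(last p, hd ys) \<in> A" using that by (auto simp: successively_append_iff)
      moreover have "hd ys \<in> V\<^sub>1 \<union> V\<^sub>2 \<union> V\<^sub>3"
        using that(1,7) hd_in_set[OF ne] by auto
      ultimately
      show ?thesis using p ne that(4,9) by blast
    qed
    have out: "A \<inter> V\<^sub>1 \<times> (V\<^sub>1 \<union> V\<^sub>2 \<union> V\<^sub>3 - V\<^sub>1) \<subseteq> UNIV \<times> V\<^sub>2"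
      "A \<inter> V\<^sub>2 \<times> (V\<^sub>1 \<union> V\<^sub>2 \<union> V\<^sub>3 - V\<^sub>2) \<subseteq> UNIV \<times> V\<^sub>3"
      using no_backward by blast+
    obtain p ys where p: "xs = p @ ys" "p \<noteq> []" "set p \<subseteq> V\<^sub>1" "ys = [] \<or> hd ys \<notin> V\<^sub>1"
      using maximal_prefixE[OF False xs(1)] .
    have ys: "ys \<noteq> []" "hd ys \<in> V\<^sub>2"
      using next_hd[OF p xs(2) "1.prems"(1,2) disjoint(3) out(1)] by simp_all
    obtain q zs where q: "ys = q @ zs" "q \<noteq> []" "set q \<subseteq> V\<^sub>2" "zs = [] \<or> hd zs \<notin> V\<^sub>2"
      using maximal_prefixE[OF ys] .
    have ys': "last ys \<in> V\<^sub>3" "path_in A ys" "set ys \<subseteq> V\<^sub>1 \<union> V\<^sub>2 \<union> V\<^sub>3"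
      using xs(2) p ys 1 by (auto simp: successively_append_iff)
    have zs: "zs \<noteq> []" "hd zs \<in> V\<^sub>3"
      using next_hd[OF q ys' disjoint(2) out(2)] by simp_all
    obtain r ws where r: "zs = r @ ws" "r \<noteq> []" "set r \<subseteq> V\<^sub>3" "ws = [] \<or> hd ws \<notin> V\<^sub>3"
      using maximal_prefixE[OF zs] .
    have paths: "path_in A p" "path_in A q" "path_in A r" "path_in A ws"
      using 1 p q r by (auto simp: successively_append_iff)
    have "hd ws \<in> V\<^sub>1 \<and> last ws \<in> V\<^sub>3" if "ws \<noteq> []"
    proof -
      have "(last r, hd ws) \<in> A"
        using that ys' q r by (auto simp: successively_append_iff)
      moreover have "last r \<in> V\<^sub>3" using r last_in_set by blast
      moreover have "hd ws \<in> V\<^sub>1 \<union> V\<^sub>2 \<union> V\<^sub>3"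
        using hd_in_set[OF that] ys'(3) q(1) r(1) by (auto)
      ultimately show ?thesis using r(4) that ys'(1) q r no_backward by auto
    qed
    moreover have "length ws < length xs" "set ws \<subseteq> V\<^sub>1 \<union> V\<^sub>2 \<union> V\<^sub>3"
      using p q r 1 by auto
    ultimately obtain ps qs rs where
      "length ps = length qs" "length qs = length rs" "paths_within V\<^sub>1 A ps"
      "paths_within V\<^sub>2 A qs" "paths_within V\<^sub>3 A rs" "interleave ps qs rs = ws"
      using 1(1) paths(4) by blast
    then show ?thesis using p q r paths
      by (intro exI[of _ "p # ps"] exI[of _ "q # qs"] exI[of _ "r # rs"]) simp
  qed
qed

lemma card_crossings_interleave:
  assumes "length ps = length qs" "length qs = length rs"
    and "paths_within V\<^sub>1 A ps" "paths_within V\<^sub>2 A qs" "paths_within V\<^sub>3 A rs"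
    and "ps \<noteq> []" "distinct (interleave ps qs rs)"
  shows "card (crossings (closed_arcs (interleave ps qs rs))) = length ps"
proof -
  let ?J = "interleave ps qs rs"
  have "crossings (closed_arcs ?J) = set (filter (\<lambda>e. e \<in> V\<^sub>3 \<times> V\<^sub>1) (arcs_to ?J (hd ?J)))"
    by (auto simp: crossings_def closed_arcs_def)
  also have "card \<dots> = length (filter (\<lambda>e. e \<in> V\<^sub>3 \<times> V\<^sub>1) (arcs_to ?J (hd ?J)))"
    by (intro distinct_card distinct_filter distinct_arcs_to assms(7))
  also have "\<dots> = length ps"
    using interleave_props(2)[OF assms(1-6)] by (intro interleave_props(3)[OF assms(1-5)]) simp
  finally show ?thesis .
qed

text \<open>The condition on \<open>k\<close> makes interleavings nonempty, as
  \<open>listings\<close> demands.\<close>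

lemma bij_betw_interleave:
  assumes "k > 0"
  shows "bij_betw (\<lambda>(ps, qs, rs). interleave ps qs rs)
    (covers V\<^sub>1 k \<times> covers V\<^sub>2 k \<times> covers V\<^sub>3 k) (listings k)"
  unfolding bij_betw_def
proof (intro conjI equalityI subsetI)
  show "inj_on (\<lambda>(ps, qs, rs). interleave ps qs rs) (covers V\<^sub>1 k \<times> covers V\<^sub>2 k \<times> covers V\<^sub>3 k)"
  proof (rule inj_onI)
    fix a b
    assume ab: "a \<in> covers V\<^sub>1 k \<times> covers V\<^sub>2 k \<times> covers V\<^sub>3 k" "b \<in> covers V\<^sub>1 k \<times> covers V\<^sub>2 k \<times> covers V\<^sub>3 k"
      "(\<lambda>(ps, qs, rs). interleave ps qs rs) a = (\<lambda>(ps, qs, rs). interleave ps qs rs) b"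
    obtain ps qs rs ps' qs' rs' where s: "a = (ps, qs, rs)" "b = (ps', qs', rs')"
      by (metis prod_cases3)
    then have "ps \<in> covers V\<^sub>1 k" "qs \<in> covers V\<^sub>2 k" "rs \<in> covers V\<^sub>3 k"
      "ps' \<in> covers V\<^sub>1 k" "qs' \<in> covers V\<^sub>2 k" "rs' \<in> covers V\<^sub>3 k"
      "interleave ps qs rs = interleave ps' qs' rs'" using ab by auto
    then have "ps = ps' \<and> qs = qs' \<and> rs = rs'"
      by (intro interleave_inject) (auto simp: covers_def)
    then show "a = b" using s by simp
  qed
next
  fix xs assume "xs \<in> (\<lambda>(ps, qs, rs). interleave ps qs rs) ` (covers V\<^sub>1 k \<times> covers V\<^sub>2 k \<times> covers V\<^sub>3 k)"
  then obtain ps qs rs where c: "ps \<in> covers V\<^sub>1 k" "qs \<in> covers V\<^sub>2 k" "rs \<in> covers V\<^sub>3 k"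
    and xs: "xs = interleave ps qs rs" by auto
  have len: "length ps = length qs" "length qs = length rs" "length ps = k" "ps \<noteq> []"
    and pw: "paths_within V\<^sub>1 A ps" "paths_within V\<^sub>2 A qs" "paths_within V\<^sub>3 A rs"
    and S: "set (concat ps) = V\<^sub>1" "set (concat qs) = V\<^sub>2" "set (concat rs) = V\<^sub>3"
    and D: "distinct (concat ps)" "distinct (concat qs)" "distinct (concat rs)"
    using c assms unfolding covers_def by auto
  note ms = mset_interleave[OF len(1,2)]
  have "distinct (concat ps @ concat qs @ concat rs)"
    unfolding distinct_append set_append S using D disjoint by blast
  then have d: "distinct xs" using mset_eq_imp_distinct_iff[OF ms] xs by blast
  have "set xs = V\<^sub>1 \<union> V\<^sub>2 \<union> V\<^sub>3"
    using mset_eq_setD[OF ms] xs unfolding set_append S by blast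
  then show "xs \<in> listings k"
    using d interleave_props[OF len(1,2) pw] card_crossings_interleave[OF len(1,2) pw len(4)] len xs
    by (simp add: listings_def)
next
  fix xs assume "xs \<in> listings k"
  then have xs: "xs \<noteq> []" "distinct xs" "set xs = V\<^sub>1 \<union> V\<^sub>2 \<union> V\<^sub>3" "path_in A xs"
    "hd xs \<in> V\<^sub>1" "last xs \<in> V\<^sub>3" "card (crossings (closed_arcs xs)) = k"
    by (auto simp: listings_def)
  obtain ps qs rs where len: "length ps = length qs" "length qs = length rs"
    and pw: "paths_within V\<^sub>1 A ps" "paths_within V\<^sub>2 A qs" "paths_within V\<^sub>3 A rs"
    and J: "interleave ps qs rs = xs"
    using interleave_surject[of xs] xs by auto
  have "ps \<noteq> []" using J xs(1) by auto
  then have k: "length ps = k"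
    using card_crossings_interleave[OF len pw] J xs by simp
  note ms = mset_interleave[OF len]
  have d: "distinct (concat ps @ concat qs @ concat rs)"
    using mset_eq_imp_distinct_iff[OF ms] J xs(2) by blast
  have s: "set (concat ps) \<union> (set (concat qs) \<union> set (concat rs)) = V\<^sub>1 \<union> V\<^sub>2 \<union> V\<^sub>3"
    using mset_eq_setD[OF ms] J xs(3) unfolding set_append by blast
  have "set (concat ps) \<subseteq> V\<^sub>1" "set (concat qs) \<subseteq> V\<^sub>2" "set (concat rs) \<subseteq> V\<^sub>3"
    using pw by (auto simp: paths_within_def)
  \<comment> \<open>Each union of paths lies in its own part and together they exhaust the disjoint
    parts.\<close>
  then have "set (concat ps) = V\<^sub>1" "set (concat qs) = V\<^sub>2" "set (concat rs) = V\<^sub>3"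
    using s disjoint by blast+
  then have "ps \<in> covers V\<^sub>1 k" "qs \<in> covers V\<^sub>2 k" "rs \<in> covers V\<^sub>3 k"
    using d pw len k by (simp_all add: covers_def)
  then show "xs \<in> (\<lambda>(ps, qs, rs). interleave ps qs rs) ` (covers V\<^sub>1 k \<times> covers V\<^sub>2 k \<times> covers V\<^sub>3 k)"
    using J by (intro image_eqI[of _ _ "(ps, qs, rs)"]) auto
qed

section \<open>Counting cycles by their number of crossings\<close>

lemma card_cycles_crossing:
  assumes "k > 0"
  shows "k * card {C \<in> cycles. card (crossings C) = k} =
    card (covers V\<^sub>1 k) * card (covers V\<^sub>2 k) * card (covers V\<^sub>3 k)"
  using bij_betw_same_card[OF bij_betw_interleave[OF assms]]
  by (simp add: card_listings card_cartesian_product)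

text \<open>The cycle meets \<open>V\<^sub>1\<close> and its complement, so some arc enters
  \<open>V\<^sub>1\<close>; its source cannot be in \<open>V\<^sub>2\<close>. This excludes
  \<open>k = 0\<close> from the count.\<close>

lemma crossings_nonempty:
  assumes "C \<in> cycles" "V\<^sub>1 \<noteq> {}" "V\<^sub>2 \<noteq> {}"
  shows "card (crossings C) > 0"
proof -
  obtain xs where xs: "C = closed_arcs xs" "set xs = V\<^sub>1 \<union> V\<^sub>2 \<union> V\<^sub>3" "C \<subseteq> A"
    using assms(1) by (auto simp: cycles_def)
  obtain u v where "u \<in> V\<^sub>1" "v \<in> V\<^sub>2" using assms by blast
  then obtain a b where ab: "(a, b) \<in> C" "a \<notin> V\<^sub>1" "b \<in> V\<^sub>1"
    using exists_entering_arc[of u xs V\<^sub>1 v] xs disjoint by blast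
  then have "(a, b) \<in> crossings C"
    using xs(3) within no_backward unfolding crossings_def by blast
  moreover have "finite (crossings C)" using xs(1) by (simp add: crossings_def)
  ultimately show ?thesis using card_gt_0_iff by blast
qed

lemma card_cycles:
  assumes "V\<^sub>1 \<noteq> {}" "V\<^sub>2 \<noteq> {}"
    and "\<And>k. k > n \<Longrightarrow> covers V\<^sub>1 k = {} \<or> covers V\<^sub>2 k = {} \<or> covers V\<^sub>3 k = {}"
  shows "real (card cycles) = (\<Sum>k = 1..n.
    real (card (covers V\<^sub>1 k)) * real (card (covers V\<^sub>2 k)) * real (card (covers V\<^sub>3 k)) / real k)"
proof -
  have "card (crossings C) \<in> {1..n}" if C: "C \<in> cycles" for C
  proof -
    define k where "k = card (crossings C)"
    have k: "k > 0" using crossings_nonempty[OF C assms(1,2)] by (simp add: k_def)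
    have "{C \<in> cycles. card (crossings C) = k} \<noteq> {}" using C by (auto simp: k_def)
    then have "card {C \<in> cycles. card (crossings C) = k} > 0"
      using finite_cycles by (simp add: card_gt_0_iff)
    \<comment> \<open>A cycle with \<open>k\<close> crossings makes the product of the three cover
      counts positive, so the assumption on empty cover sets forces \<open>k\<close> to be at most
      \<open>n\<close>.\<close>
    then have "0 < k * card {C \<in> cycles. card (crossings C) = k}" using k by simp
    then have pos: "0 < card (covers V\<^sub>1 k) * card (covers V\<^sub>2 k) * card (covers V\<^sub>3 k)"
      by (simp only: card_cycles_crossing[OF k])
    have "\<not> k > n"
    proof
      assume "k > n"
      from assms(3)[OF this] pos show False by (elim disjE) simp_all
    qed
    then show ?thesis using k by (simp add: k_def)
  qed
  then have "cycles = (\<Union>k\<in>{1..n}. {C \<in> cycles. card (crossings C) = k})" by auto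
  then have "card cycles = card (\<Union>k\<in>{1..n}. {C \<in> cycles. card (crossings C) = k})" by simp
  also have "\<dots> = (\<Sum>k = 1..n. card {C \<in> cycles. card (crossings C) = k})"
    using finite_cycles by (intro card_UN_disjoint) auto
  finally have "real (card cycles) = (\<Sum>k = 1..n. real (card {C \<in> cycles. card (crossings C) = k}))"
    by simp
  also have "\<dots> = (\<Sum>k = 1..n.
    real (card (covers V\<^sub>1 k)) * real (card (covers V\<^sub>2 k)) * real (card (covers V\<^sub>3 k)) / real k)"
  proof (rule sum.cong[OF refl])
    fix k assume "k \<in> {1..n}"
    then have "k > 0" by simp
    then show "real (card {C \<in> cycles. card (crossings C) = k}) =
      real (card (covers V\<^sub>1 k)) * real (card (covers V\<^sub>2 k)) * real (card (covers V\<^sub>3 k)) / real k"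
      using card_cycles_crossing[OF \<open>k > 0\<close>, THEN arg_cong[where f = real]]
      by (simp add: field_simps)
  qed
  finally show ?thesis .
qed

end

section \<open>Counting Hamilton cycles\<close>

lemma cyclic_triple_C3:
  assumes T: "tournament T\<^sub>1" "tournament T\<^sub>2" "tournament T\<^sub>3"
    and disj: "pverts T\<^sub>1 \<inter> pverts T\<^sub>2 = {}" "pverts T\<^sub>2 \<inter> pverts T\<^sub>3 = {}" "pverts T\<^sub>1 \<inter> pverts T\<^sub>3 = {}"
  shows "cyclic_triple (pverts T\<^sub>1) (pverts T\<^sub>2) (pverts T\<^sub>3) (parcs (C3 T\<^sub>1 T\<^sub>2 T\<^sub>3))"
proof
  show "finite (pverts T\<^sub>1)" "finite (pverts T\<^sub>2)" "finite (pverts T\<^sub>3)"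
    using T by (auto simp: tournament_def pair_digraph_def pair_fin_digraph.pair_finite_verts)
qed (use disj T[THEN tournament.parcs_subset] in \<open>auto simp: C3_def\<close>)

text \<open>By this symmetry, \<open>covers_C3\<close>, which treats the first part, yields the
  covers of all three.\<close>

lemma C3_rotate: "C3 T\<^sub>1 T\<^sub>2 T\<^sub>3 = C3 T\<^sub>2 T\<^sub>3 T\<^sub>1"
  by (auto simp: C3_def)

lemma covers_C3:
  assumes T: "tournament T\<^sub>1" "tournament T\<^sub>2" "tournament T\<^sub>3"
    and disj: "pverts T\<^sub>1 \<inter> pverts T\<^sub>2 = {}" "pverts T\<^sub>2 \<inter> pverts T\<^sub>3 = {}" "pverts T\<^sub>1 \<inter> pverts T\<^sub>3 = {}"
  shows "cyclic_triple.covers (parcs (C3 T\<^sub>1 T\<^sub>2 T\<^sub>3)) (pverts T\<^sub>1) k = ordered_path_covers T\<^sub>1 k"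
proof -
  interpret cyclic_triple "pverts T\<^sub>1" "pverts T\<^sub>2" "pverts T\<^sub>3" "parcs (C3 T\<^sub>1 T\<^sub>2 T\<^sub>3)"
    using assms by (rule cyclic_triple_C3)
  have arcs: "(u, v) \<in> parcs (C3 T\<^sub>1 T\<^sub>2 T\<^sub>3) \<longleftrightarrow> (u, v) \<in> parcs T\<^sub>1"
    if "u \<in> pverts T\<^sub>1" "v \<in> pverts T\<^sub>1" for u v
    using that disj T[THEN tournament.parcs_subset] by (auto simp: C3_def)
  have path: "path_in (parcs (C3 T\<^sub>1 T\<^sub>2 T\<^sub>3)) p \<longleftrightarrow> path_in (parcs T\<^sub>1) p" if "set p \<subseteq> pverts T\<^sub>1" for p
    using that arcs by (intro successively_cong) auto
  show ?thesis
    unfolding covers_def ordered_path_covers_def paths_within_def using path by fastforce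
qed

theorem theorem1:
  fixes T\<^sub>1 T\<^sub>2 T\<^sub>3 :: "'a pair_pre_digraph" and m\<^sub>1 m\<^sub>2 m\<^sub>3 :: nat
  assumes "m\<^sub>1 > 0" "m\<^sub>2 > 0" "m\<^sub>3 > 0"
    and "tournament T\<^sub>1" "tournament T\<^sub>2" "tournament T\<^sub>3"
    and "card (pverts T\<^sub>1) = m\<^sub>1" "card (pverts T\<^sub>2) = m\<^sub>2" "card (pverts T\<^sub>3) = m\<^sub>3"
    and "pverts T\<^sub>1 \<inter> pverts T\<^sub>2 = {}" "pverts T\<^sub>2 \<inter> pverts T\<^sub>3 = {}" "pverts T\<^sub>1 \<inter> pverts T\<^sub>3 = {}"
  shows "real (card (hamilton_cycles (C3 T\<^sub>1 T\<^sub>2 T\<^sub>3))) \<ge>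
      (\<Sum>k = 1..Min {m\<^sub>1, m\<^sub>2, m\<^sub>3}.
        real (Stirling m\<^sub>1 k) * real (Stirling m\<^sub>2 k) * real (Stirling m\<^sub>3 k) * (fact k ^ 3 / real k))
    \<and> (transitive_tournament T\<^sub>1 \<and> transitive_tournament T\<^sub>2 \<and> transitive_tournament T\<^sub>3 \<longrightarrow>
      real (card (hamilton_cycles (C3 T\<^sub>1 T\<^sub>2 T\<^sub>3))) =
        (\<Sum>k = 1..Min {m\<^sub>1, m\<^sub>2, m\<^sub>3}.
          real (Stirling m\<^sub>1 k) * real (Stirling m\<^sub>2 k) * real (Stirling m\<^sub>3 k) * (fact k ^ 3 / real k)))"
proof -
  let ?A = "parcs (C3 T\<^sub>1 T\<^sub>2 T\<^sub>3)"
  interpret cyclic_triple "pverts T\<^sub>1" "pverts T\<^sub>2" "pverts T\<^sub>3" ?A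
    using assms by (intro cyclic_triple_C3)
  define P where "P = (\<lambda>T k. real (card (ordered_path_covers (T :: 'a pair_pre_digraph) k)))"
  have cov: "covers (pverts T\<^sub>1) k = ordered_path_covers T\<^sub>1 k" "covers (pverts T\<^sub>2) k = ordered_path_covers T\<^sub>2 k"
    "covers (pverts T\<^sub>3) k = ordered_path_covers T\<^sub>3 k" for k
    using covers_C3[of T\<^sub>1 T\<^sub>2 T\<^sub>3 k] covers_C3[of T\<^sub>2 T\<^sub>3 T\<^sub>1 k] covers_C3[of T\<^sub>3 T\<^sub>1 T\<^sub>2 k] assms
    by (simp_all add: C3_rotate[of T\<^sub>1 T\<^sub>2 T\<^sub>3] C3_rotate[of T\<^sub>3 T\<^sub>1 T\<^sub>2] Int_commute)
  have verts: "pverts (C3 T\<^sub>1 T\<^sub>2 T\<^sub>3) = pverts T\<^sub>1 \<union> pverts T\<^sub>2 \<union> pverts T\<^sub>3"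
    by (simp add: C3_def)
  have ham: "hamilton_cycles (C3 T\<^sub>1 T\<^sub>2 T\<^sub>3) = cycles"
    using hamilton_cycles_eq[of "C3 T\<^sub>1 T\<^sub>2 T\<^sub>3"] within
    unfolding cycles_def by (simp add: verts)
  have ne: "pverts T\<^sub>1 \<noteq> {}" "pverts T\<^sub>2 \<noteq> {}" using assms by auto
  have no_covers: "covers (pverts T\<^sub>1) k = {} \<or> covers (pverts T\<^sub>2) k = {} \<or> covers (pverts T\<^sub>3) k = {}"
    if "k > Min {m\<^sub>1, m\<^sub>2, m\<^sub>3}" for k
  proof (rule ccontr)
    assume "\<not> ?thesis"
    then obtain ps qs rs where "ps \<in> ordered_path_covers T\<^sub>1 k" "qs \<in> ordered_path_covers T\<^sub>2 k"
      "rs \<in> ordered_path_covers T\<^sub>3 k" by (auto simp: cov)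
    then have "k \<le> m\<^sub>1" "k \<le> m\<^sub>2" "k \<le> m\<^sub>3"
      using tournament.length_ordered_path_cover assms by metis+
    then show False using that by simp
  qed
  have H: "real (card (hamilton_cycles (C3 T\<^sub>1 T\<^sub>2 T\<^sub>3))) =
      (\<Sum>k = 1..Min {m\<^sub>1, m\<^sub>2, m\<^sub>3}. P T\<^sub>1 k * P T\<^sub>2 k * P T\<^sub>3 k / real k)"
    unfolding ham P_def using card_cycles[OF ne no_covers] by (simp only: cov)
  \<comment> \<open>One factorial goes to each Stirling number, giving the three counts of ordered
    partitions, so that the sums can be compared termwise.\<close>
  have S: "real (Stirling m\<^sub>1 k) * real (Stirling m\<^sub>2 k) * real (Stirling m\<^sub>3 k) * (fact k ^ 3 / real k) =
      (real (Stirling m\<^sub>1 k) * fact k) * (real (Stirling m\<^sub>2 k) * fact k) *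
      (real (Stirling m\<^sub>3 k) * fact k) / real k" for k
    by (simp add: power3_eq_cube)
  have ge: "real (Stirling (card (pverts T)) k) * fact k \<le> P T k" if "tournament T" 
    for T :: "'a pair_pre_digraph" and k
    using tournament.card_ordered_path_covers_ge[OF that, of k]
    unfolding P_def by (metis of_nat_fact of_nat_le_iff of_nat_mult)
  have eq: "P T k = real (Stirling (card (pverts T)) k) * fact k" if "transitive_tournament T" 
    for T :: "'a pair_pre_digraph" and k
    using transitive_tournament.card_ordered_path_covers[OF that, of k]
    unfolding P_def by simp
  have "real (Stirling m\<^sub>1 k) * fact k \<le> P T\<^sub>1 k" "real (Stirling m\<^sub>2 k) * fact k \<le> P T\<^sub>2 k"
    "real (Stirling m\<^sub>3 k) * fact k \<le> P T\<^sub>3 k" for k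
    using ge assms by metis+
  then have "(\<Sum>k = 1..Min {m\<^sub>1, m\<^sub>2, m\<^sub>3}.
      real (Stirling m\<^sub>1 k) * real (Stirling m\<^sub>2 k) * real (Stirling m\<^sub>3 k) * (fact k ^ 3 / real k))
    \<le> real (card (hamilton_cycles (C3 T\<^sub>1 T\<^sub>2 T\<^sub>3)))"
    unfolding H S by (intro sum_mono divide_right_mono mult_mono) (auto simp: P_def)
  moreover have "real (card (hamilton_cycles (C3 T\<^sub>1 T\<^sub>2 T\<^sub>3))) = (\<Sum>k = 1..Min {m\<^sub>1, m\<^sub>2, m\<^sub>3}.
      real (Stirling m\<^sub>1 k) * real (Stirling m\<^sub>2 k) * real (Stirling m\<^sub>3 k) * (fact k ^ 3 / real k))"
    if "transitive_tournament T\<^sub>1" "transitive_tournament T\<^sub>2" "transitive_tournament T\<^sub>3"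
    unfolding H S by (simp only: eq[OF that(1)] eq[OF that(2)] eq[OF that(3)] assms(7-9))
  ultimately show ?thesis by blast
qed

end
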